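(* Let $V$ be a finite non-empty set and let $\{X_v: v\in V\}$ be discrete-valued i.i.d. random variables, taking values in $\Omega$, with finite entropy. Let $f:\Omega^V\to\mathbb R$ be a transitive function, and let $Z=f(X_V)$, with $H(Z)>0$. Then for every $U\subseteq V$, $$\mathrm{clue}^{I}(f\mid U)\leq \frac{|U|}{|V|}.$$
   Context: For $S\subseteq V$, $X_S:=\{X_v:v\in S\}$. For discrete random variables, $H(Z):=-\sum_z\mathbb P[Z=z]\log\mathbb P[Z=z]$ is the entropy and $I(Z:X):=H(Z)+H(X)-H(Z,X)$ is the mutual information. The information theoretic clue of $f$ with respect to $U\subseteq V$ is $$\mathrm{clue}^I(f\mid U):=\frac{I(Z:X_U)}{I(Z:X_V)}=\frac{I(Z:X_U)}{H(Z)}.$$ A function $f:\Omega^V\to\mathbb R$ is transitive if there is a group $\Gamma$ of permutations of $V$ acting transitively on $V$ such that $f$ is invariant under the induced action of $\Gamma$ on $\Omega^V$ by permutation of coordinates. *)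

theory Defs
  imports "HOL-Probability.Probability" "HOL-Algebra.Bij"
begin

definition discrete_rv :: "'m measure \<Rightarrow> 'a set \<Rightarrow> ('m \<Rightarrow> 'a) \<Rightarrow> bool" where
  "discrete_rv M \<Omega> Y \<longleftrightarrow> Y \<in> M \<rightarrow>\<^sub>M count_space \<Omega> \<and> countable (Y ` space M)"

definition point_prob :: "'m measure \<Rightarrow> ('m \<Rightarrow> 'a) \<Rightarrow> 'a \<Rightarrow> real" where
  "point_prob M Y y = measure M {\<omega> \<in> space M. Y \<omega> = y}"

(* The sums range over the whole type; terms outside the range of Y vanish because ln 0 = 0.
   infsum returns 0 on divergent sums, so finiteness is the separate predicate finite_entropy_rv. *)
definition discrete_entropy :: "'m measure \<Rightarrow> ('m \<Rightarrow> 'a) \<Rightarrow> real" where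
  "discrete_entropy M Y = - (\<Sum>\<^sub>\<infinity>y. point_prob M Y y * ln (point_prob M Y y))"

definition finite_entropy_rv :: "'m measure \<Rightarrow> ('m \<Rightarrow> 'a) \<Rightarrow> bool" where
  "finite_entropy_rv M Y \<longleftrightarrow> (\<lambda>y. point_prob M Y y * ln (point_prob M Y y)) summable_on UNIV"

definition mutual_info :: "'m measure \<Rightarrow> ('m \<Rightarrow> 'a) \<Rightarrow> ('m \<Rightarrow> 'b) \<Rightarrow> real" where
  "mutual_info M Z Y =
     discrete_entropy M Z + discrete_entropy M Y - discrete_entropy M (\<lambda>\<omega>. (Z \<omega>, Y \<omega>))"

definition subfamily :: "('v \<Rightarrow> 'm \<Rightarrow> 'a) \<Rightarrow> 'v set \<Rightarrow> 'm \<Rightarrow> ('v \<Rightarrow> 'a)" where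
  "subfamily X S \<omega> = (\<lambda>v\<in>S. X v \<omega>)"

definition clue_I ::
  "'m measure \<Rightarrow> ('v \<Rightarrow> 'm \<Rightarrow> 'a) \<Rightarrow> 'v set \<Rightarrow> (('v \<Rightarrow> 'a) \<Rightarrow> real) \<Rightarrow> 'v set \<Rightarrow> real" where
  "clue_I M X V f U =
     (let Z = (\<lambda>\<omega>. f (subfamily X V \<omega>))
      in mutual_info M Z (subfamily X U) / mutual_info M Z (subfamily X V))"

(* x composed with \<gamma> is the image of x under the inverse of \<gamma>; as \<Gamma> is a group, quantifying over
   all \<gamma> gives invariance under the induced left action. *)
definition transitive_function :: "'v set \<Rightarrow> 'a set \<Rightarrow> (('v \<Rightarrow> 'a) \<Rightarrow> real) \<Rightarrow> bool" where
  "transitive_function V \<Omega> f \<longleftrightarrow>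
     (\<exists>\<Gamma>. subgroup \<Gamma> (BijGroup V) \<and>
          (\<forall>u\<in>V. \<forall>v\<in>V. \<exists>\<gamma>\<in>\<Gamma>. \<gamma> u = v) \<and>
          (\<forall>\<gamma>\<in>\<Gamma>. \<forall>x \<in> V \<rightarrow>\<^sub>E \<Omega>. f (\<lambda>v\<in>V. x (\<gamma> v)) = f x))"

lemma discrete_entropy_graph:
  "discrete_entropy M (\<lambda>\<omega>. (g (Y \<omega>), Y \<omega>)) = discrete_entropy M Y"
proof -
  let ?P = "\<lambda>p. point_prob M (\<lambda>\<omega>. (g (Y \<omega>), Y \<omega>)) p"
  have on: "?P (g y, y) = point_prob M Y y" for y
    unfolding point_prob_def by (rule arg_cong[where f = "measure M"]) auto
  have off: "?P p = 0" if "p \<notin> range (\<lambda>y. (g y, y))" for p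
  proof -
    have "{\<omega> \<in> space M. (g (Y \<omega>), Y \<omega>) = p} = {}"
      using that by auto
    then show ?thesis by (simp only: point_prob_def measure_empty)
  qed
  have "(\<Sum>\<^sub>\<infinity>p. ?P p * ln (?P p)) = (\<Sum>\<^sub>\<infinity>p\<in>range (\<lambda>y. (g y, y)). ?P p * ln (?P p))"
    by (rule infsum_cong_neutral) (auto simp: off)
  also have "\<dots> = (\<Sum>\<^sub>\<infinity>y. point_prob M Y y * ln (point_prob M Y y))"
    by (subst infsum_reindex) (auto simp: inj_on_def o_def on)
  finally show ?thesis by (simp add: discrete_entropy_def)
qed

lemma clue_I_eq_entropy_ratio:
  "clue_I M X V f U =
     mutual_info M (\<lambda>\<omega>. f (subfamily X V \<omega>)) (subfamily X U) /
     discrete_entropy M (\<lambda>\<omega>. f (subfamily X V \<omega>))"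
  by (simp add: clue_I_def Let_def mutual_info_def[of M _ "subfamily X V"] discrete_entropy_graph)

end

theory Submission
  imports Defs
begin

text \<open>
  By independence \<open>H(X_S)\<close> is additive in \<open>S\<close>, while \<open>H(Z, X_S)\<close> is submodular; hence
  \<open>g(S) = I(Z : X_S)\<close> is supermodular, with \<open>g({}) = 0\<close> and \<open>g(V) = H(Z)\<close>. Viewed as a convex
  cooperative game, \<open>g\<close> has a nonempty core: there are weights \<open>d\<close> on \<open>V\<close> with total weight \<open>g(V)\<close>
  such that \<open>g(S)\<close> is at most the weight of \<open>S\<close>. Since the coordinates are identically distributed
  and \<open>f\<close> is \<open>\<Gamma>\<close>-invariant, so is \<open>g\<close>, and averaging the weights over the transitive group \<open>\<Gamma>\<close> makes
  them constant, equal to \<open>g(V) / |V|\<close>.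
\<close>

section \<open>Core of a supermodular set function and its symmetrization\<close>

lemma supermodular_core_exists:
  fixes g :: "'v set \<Rightarrow> real"
  assumes "finite V" and "g {} = 0"
    and "\<And>S T. S \<subseteq> V \<Longrightarrow> T \<subseteq> V \<Longrightarrow> g S + g T \<le> g (S \<union> T) + g (S \<inter> T)"
  shows "\<exists>d. (\<forall>S\<subseteq>V. g S \<le> sum d S) \<and> sum d V = g V"
  \<comment> \<open>The core element is the vector of marginal contributions along an enumeration of \<open>V\<close>.\<close>
  using assms
proof (induction V rule: finite_induct)
  case empty
  then show ?case by auto
next
  case (insert v V)
  have "\<exists>d. (\<forall>S\<subseteq>V. g S \<le> sum d S) \<and> sum d V = g V"
    using insert.prems by (intro insert.IH) auto
  then obtain d where d: "\<And>S. S \<subseteq> V \<Longrightarrow> g S \<le> sum d S" "sum d V = g V"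
    by blast
  define d' where "d' = d(v := g (insert v V) - g V)"
  have d'_eq: "sum d' S = sum d S" if "S \<subseteq> V" for S
    using that insert.hyps by (intro sum.cong) (auto simp: d'_def)
  have "g S \<le> sum d' S" if S: "S \<subseteq> insert v V" for S
  proof (cases "v \<in> S")
    case False
    then have "S \<subseteq> V" using S by auto
    then show ?thesis using d(1) d'_eq by simp
  next
    case True
    define T where "T = S - {v}"
    have T: "T \<subseteq> V" "v \<notin> T" "S = insert v T" "finite T"
      using True S insert.hyps by (auto simp: T_def intro: finite_subset)
    \<comment> \<open>Supermodularity for \<open>S\<close> and \<open>V\<close> says that
      \<open>v\<close> contributes at most as much to \<open>T\<close> as to the larger set
      \<open>V\<close>; the latter contribution is \<open>d' v\<close>.\<close>
    have "g S + g V \<le> g (S \<union> V) + g (S \<inter> V)"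
      using S by (intro insert.prems) auto
    moreover have "S \<union> V = insert v V" "S \<inter> V = T"
      using T insert.hyps by auto
    ultimately have "g S \<le> d' v + g T" by (simp add: d'_def)
    also have "\<dots> \<le> d' v + sum d' T" using d(1)[OF T(1)] d'_eq[OF T(1)] by simp
    also have "\<dots> = sum d' S" using T by simp
    finally show ?thesis .
  qed
  moreover have "sum d' (insert v V) = g (insert v V)"
    using insert.hyps d(2) d'_eq[of V] by (simp add: d'_def)
  ultimately show ?case by blast
qed

text \<open>A core vector \<open>d\<close> need not share the symmetry of \<open>g\<close>. Adding
  up its constraints at all translates of \<open>U\<close> replaces \<open>d\<close> by orbit sums,
  which transitivity makes constant on \<open>V\<close>. The cross-multiplied form spares a case
  distinction for empty \<open>V\<close>.\<close>

lemma supermodular_transitive_bound: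
  fixes g :: "'v set \<Rightarrow> real"
  assumes V: "finite V" and g0: "g {} = 0"
    and super: "\<And>S T. S \<subseteq> V \<Longrightarrow> T \<subseteq> V \<Longrightarrow> g S + g T \<le> g (S \<union> T) + g (S \<inter> T)"
    and \<Gamma>: "subgroup \<Gamma> (BijGroup V)"
    and trans: "\<And>u v. u \<in> V \<Longrightarrow> v \<in> V \<Longrightarrow> \<exists>\<gamma>\<in>\<Gamma>. \<gamma> u = v"
    and inv: "\<And>\<gamma> S. \<gamma> \<in> \<Gamma> \<Longrightarrow> S \<subseteq> V \<Longrightarrow> g (\<gamma> ` S) = g S"
    and U: "U \<subseteq> V"
  shows "real (card V) * g U \<le> real (card U) * g V"
proof -
  obtain d where d: "\<And>S. S \<subseteq> V \<Longrightarrow> g S \<le> sum d S" "sum d V = g V"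
    using supermodular_core_exists[OF V g0 super] by blast
  interpret G: group "BijGroup V" by (rule group_BijGroup)
  interpret \<Gamma>: subgroup \<Gamma> "BijGroup V" by (rule \<Gamma>)
  have Bij: "\<gamma> \<in> Bij V" if "\<gamma> \<in> \<Gamma>" for \<gamma>
    using \<Gamma>.mem_carrier[OF that] by (simp add: BijGroup_def)
  have bij: "bij_betw \<gamma> V V" if "\<gamma> \<in> \<Gamma>" for \<gamma>
    using Bij[OF that] by (simp add: Bij_def)
  \<comment> \<open>Elements of \<open>BijGroup V\<close> are extensional, so
    \<open>\<Gamma>\<close> sits inside a finite function space and can be summed over.\<close>
  have "\<gamma> \<in> V \<rightarrow>\<^sub>E V" if "\<gamma> \<in> \<Gamma>" for \<gamma>
    using Bij_imp_extensional[OF Bij[OF that]] Bij_imp_funcset[OF Bij[OF that]] by (simp add: PiE_def)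
  then have "\<Gamma> \<subseteq> V \<rightarrow>\<^sub>E V" by blast
  then have fin: "finite \<Gamma>"
    using V by (meson finite_PiE finite_subset)
  have ne: "card \<Gamma> > 0" using fin \<Gamma>.one_closed card_gt_0_iff by blast
  \<comment> \<open>\<open>D\<close> is the average of \<open>d\<close> over the group, left
    unnormalized.\<close>
  define D where "D u = (\<Sum>\<gamma>\<in>\<Gamma>. d (\<gamma> u))" for u
  have D_eq: "D u = D v" if uv: "u \<in> V" "v \<in> V" for u v
  proof -
    obtain \<delta> where \<delta>: "\<delta> \<in> \<Gamma>" "\<delta> u = v" using trans[OF uv] by blast
    have mult: "\<gamma> \<otimes>\<^bsub>BijGroup V\<^esub> \<delta> = compose V \<gamma> \<delta>" if "\<gamma> \<in> \<Gamma>" for \<gamma>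
      using Bij[OF that] Bij[OF \<delta>(1)] by (simp add: BijGroup_def)
    \<comment> \<open>Right translation by \<open>\<delta>\<close> permutes \<open>\<Gamma>\<close>,
      and the translated summand at \<open>u\<close> is the original one at
      \<open>\<delta> u = v\<close>.\<close>
    have "bij_betw (\<lambda>\<gamma>. \<gamma> \<otimes>\<^bsub>BijGroup V\<^esub> \<delta>) \<Gamma> \<Gamma>"
    proof (rule bij_betwI[where g = "\<lambda>\<gamma>. \<gamma> \<otimes>\<^bsub>BijGroup V\<^esub> inv\<^bsub>BijGroup V\<^esub> \<delta>"])
      show "\<gamma> \<otimes>\<^bsub>BijGroup V\<^esub> \<delta> \<otimes>\<^bsub>BijGroup V\<^esub> inv\<^bsub>BijGroup V\<^esub> \<delta> = \<gamma>" if "\<gamma> \<in> \<Gamma>" for \<gamma>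
        using that \<delta>(1) by (simp add: G.m_assoc)
      show "\<gamma> \<otimes>\<^bsub>BijGroup V\<^esub> inv\<^bsub>BijGroup V\<^esub> \<delta> \<otimes>\<^bsub>BijGroup V\<^esub> \<delta> = \<gamma>" if "\<gamma> \<in> \<Gamma>" for \<gamma>
        using that \<delta>(1) by (simp add: G.m_assoc)
    qed (use \<delta>(1) in auto)
    then have "D u = (\<Sum>\<gamma>\<in>\<Gamma>. d ((\<gamma> \<otimes>\<^bsub>BijGroup V\<^esub> \<delta>) u))"
      unfolding D_def by (rule sum.reindex_bij_betw[symmetric])
    also have "\<dots> = D v"
      unfolding D_def using \<delta> uv by (intro sum.cong) (auto simp: mult compose_def)
    finally show ?thesis .
  qed
  have D: "real (card V) * D u = real (card \<Gamma>) * g V" if "u \<in> V" for u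
  proof -
    \<comment> \<open>Double counting: \<open>D\<close> is constant on \<open>V\<close>, while each
      group element permutes \<open>V\<close> and so preserves the total weight
      \<open>g V\<close>.\<close>
    have "real (card V) * D u = (\<Sum>v\<in>V. D v)"
      using D_eq[OF _ that] by simp
    also have "\<dots> = (\<Sum>\<gamma>\<in>\<Gamma>. \<Sum>v\<in>V. d (\<gamma> v))"
      unfolding D_def by (rule sum.swap)
    also have "\<dots> = (\<Sum>\<gamma>\<in>\<Gamma>. g V)"
      using sum.reindex_bij_betw[OF bij, of _ d] d(2) by simp
    finally show ?thesis by simp
  qed
  have "real (card \<Gamma>) * g U = (\<Sum>\<gamma>\<in>\<Gamma>. g (\<gamma> ` U))"
    using inv U by simp
  also have "\<dots> \<le> (\<Sum>\<gamma>\<in>\<Gamma>. \<Sum>u\<in>U. d (\<gamma> u))"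
  proof (rule sum_mono)
    fix \<gamma> assume \<gamma>: "\<gamma> \<in> \<Gamma>"
    have "\<gamma> ` U \<subseteq> V" using bij[OF \<gamma>] U by (auto simp: bij_betw_def)
    moreover have "inj_on \<gamma> U" using bij[OF \<gamma>] U by (auto simp: bij_betw_def inj_on_subset)
    ultimately show "g (\<gamma> ` U) \<le> (\<Sum>u\<in>U. d (\<gamma> u))"
      using d(1)[of "\<gamma> ` U"] by (simp add: sum.reindex)
  qed
  also have "\<dots> = (\<Sum>u\<in>U. D u)"
    unfolding D_def by (rule sum.swap)
  finally have "real (card V) * (real (card \<Gamma>) * g U) \<le> real (card V) * (\<Sum>u\<in>U. D u)"
    by (rule mult_left_mono) simp
  also have "\<dots> = (\<Sum>u\<in>U. real (card \<Gamma>) * g V)"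
    unfolding sum_distrib_left using U D by (intro sum.cong) auto
  also have "\<dots> = real (card U) * (real (card \<Gamma>) * g V)" by simp
  finally have "real (card \<Gamma>) * (real (card V) * g U) \<le> real (card \<Gamma>) * (real (card U) * g V)"
    by (simp add: mult_ac)
  then show ?thesis using ne by simp
qed

section \<open>Entropy of a function on a pmf, and its monotonicity\<close>

text \<open>
  \<open>pmf_entropy P A\<close> is the entropy of \<open>A x\<close> for \<open>x\<close> drawn from \<open>P\<close>. Written as an expectation over \<open>P\<close>,
  it visibly depends only on the partition of the support into fibers of \<open>A\<close>.
\<close>

definition pmf_entropy :: "'x pmf \<Rightarrow> ('x \<Rightarrow> 'y) \<Rightarrow> real" where
  "pmf_entropy P A = measure_pmf.expectation P (\<lambda>x. - ln (pmf (map_pmf A P) (A x)))"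

text \<open>The Bochner integral of a non-integrable function is 0, so finiteness has to be recorded
  separately.\<close>

definition finite_pmf_entropy :: "'x pmf \<Rightarrow> ('x \<Rightarrow> 'y) \<Rightarrow> bool" where
  "finite_pmf_entropy P A \<longleftrightarrow> integrable (measure_pmf P) (\<lambda>x. - ln (pmf (map_pmf A P) (A x)))"

lemma pmf_map_fiber: "pmf (map_pmf A P) (A x) = measure_pmf.prob P {y. A y = A x}"
  by (simp add: pmf_map vimage_def)

lemma pmf_map_fiber_pos: "x \<in> set_pmf P \<Longrightarrow> 0 < pmf (map_pmf A P) (A x)"
  by (simp add: pmf_positive)

text \<open>If \<open>A\<close> determines \<open>B\<close> on the support, each fiber of
  \<open>A\<close> through a support point lies in the fiber of \<open>B\<close> up to a null
  set.\<close>

lemma pmf_map_fiber_mono: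
  assumes "\<And>x y. x \<in> set_pmf P \<Longrightarrow> y \<in> set_pmf P \<Longrightarrow> A x = A y \<Longrightarrow> B x = B y"
    and "x \<in> set_pmf P"
  shows "pmf (map_pmf A P) (A x) \<le> pmf (map_pmf B P) (B x)"
  unfolding pmf_map_fiber
proof (rule measure_pmf.finite_measure_mono_AE)
  show "AE y in measure_pmf P. y \<in> {y. A y = A x} \<longrightarrow> y \<in> {y. B y = B x}"
    unfolding AE_measure_pmf_iff using assms by blast
qed simp

text \<open>Coarser fibers are more probable, so \<open>- ln\<close> of the fiber probability is
  smaller for \<open>B\<close> than for \<open>A\<close>; both are nonnegative since probabilities
  are at most 1. Domination gives integrability.\<close>

lemma finite_pmf_entropy_mono:
  assumes "finite_pmf_entropy P A"
    and "\<And>x y. x \<in> set_pmf P \<Longrightarrow> y \<in> set_pmf P \<Longrightarrow> A x = A y \<Longrightarrow> B x = B y"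
  shows "finite_pmf_entropy P B"
  unfolding finite_pmf_entropy_def
proof (rule Bochner_Integration.integrable_bound)
  show "integrable (measure_pmf P) (\<lambda>x. - ln (pmf (map_pmf A P) (A x)))"
    using assms(1) by (simp add: finite_pmf_entropy_def)
  have "\<bar>- ln (pmf (map_pmf B P) (B x))\<bar> \<le> \<bar>- ln (pmf (map_pmf A P) (A x))\<bar>"
    if x: "x \<in> set_pmf P" for x
  proof -
    have "0 < pmf (map_pmf A P) (A x)" by (rule pmf_map_fiber_pos[OF x])
    moreover have "pmf (map_pmf A P) (A x) \<le> pmf (map_pmf B P) (B x)"
      using assms(2) x by (rule pmf_map_fiber_mono)
    ultimately have "ln (pmf (map_pmf A P) (A x)) \<le> ln (pmf (map_pmf B P) (B x))" by simp
    moreover have "ln (pmf (map_pmf B P) (B x)) \<le> 0"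
      by (rule ln_le_zero_iff[THEN iffD2, OF pmf_map_fiber_pos[OF x] pmf_le_1])
    ultimately show ?thesis by simp
  qed
  then show "AE x in measure_pmf P.
      norm (- ln (pmf (map_pmf B P) (B x))) \<le> norm (- ln (pmf (map_pmf A P) (A x)))"
    by (simp add: AE_measure_pmf_iff)
qed simp

text \<open>Fiber monotonicity in both directions. This allows one encoding of the same information
  to be exchanged for another, even of a different type.\<close>

lemma pmf_entropy_cong:
  assumes "\<And>x y. x \<in> set_pmf P \<Longrightarrow> y \<in> set_pmf P \<Longrightarrow> A x = A y \<longleftrightarrow> B x = B y"
  shows "pmf_entropy P A = pmf_entropy P B"
proof -
  have "pmf (map_pmf A P) (A x) = pmf (map_pmf B P) (B x)" if "x \<in> set_pmf P" for x
    using that assms by (intro antisym pmf_map_fiber_mono) auto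
  then show ?thesis
    unfolding pmf_entropy_def by (intro integral_cong_AE) (auto simp: AE_measure_pmf_iff)
qed

lemma pmf_entropy_map_pmf: "pmf_entropy (map_pmf T P) A = pmf_entropy P (A \<circ> T)"
  by (simp add: pmf_entropy_def pmf.map_comp)

section \<open>Submodularity of entropy\<close>

lemma nn_integral_pmf_map_snd:
  "(\<integral>\<^sup>+ b. ennreal (pmf Q (b, c)) \<partial>count_space UNIV) = ennreal (pmf (map_pmf snd Q) c)"
proof -
  have "(\<integral>\<^sup>+ b. ennreal (pmf Q (b, c)) \<partial>count_space UNIV)
      = (\<integral>\<^sup>+ x. ennreal (pmf Q x) \<partial>count_space (snd -` {c}))"
    by (rule nn_integral_bij_count_space[where g = "\<lambda>b. (b, c)"])
       (auto simp: bij_betw_def inj_on_def)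
  then show ?thesis
    by (simp add: nn_integral_pmf pmf_map measure_pmf.emeasure_eq_measure)
qed

text \<open>
  Gibbs' inequality \<open>ln t \<le> t - 1\<close> for the ratio between the conditionally independent coupling
  \<open>p(a, c) p(b, c) / p(c)\<close> and the joint law.
\<close>

lemma pmf_entropy_submodular:
  fixes A :: "'x \<Rightarrow> 'a" and B :: "'x \<Rightarrow> 'b" and C :: "'x \<Rightarrow> 'c"
  assumes fin: "finite_pmf_entropy P (\<lambda>x. (A x, B x, C x))"
  shows "pmf_entropy P (\<lambda>x. (A x, B x, C x)) + pmf_entropy P C
    \<le> pmf_entropy P (\<lambda>x. (A x, C x)) + pmf_entropy P (\<lambda>x. (B x, C x))"
proof -
  define J where "J = map_pmf (\<lambda>x. (A x, B x, C x)) P"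
  define PA where "PA = map_pmf (\<lambda>x. (A x, C x)) P"
  define PB where "PB = map_pmf (\<lambda>x. (B x, C x)) P"
  define PC where "PC = map_pmf C P"
  \<comment> \<open>Where \<open>pmf PC c = 0\<close> the quotient is 0 by convention. The argument
    uses only that the total mass of \<open>r\<close> is at most 1.\<close>
  define r where "r = (\<lambda>(a, b, c). pmf PA (a, c) * pmf PB (b, c) / pmf PC c)"
  have sndB: "map_pmf snd PB = PC"
    by (simp add: PB_def PC_def pmf.map_comp o_def)
  have inner: "(\<integral>\<^sup>+ b. ennreal (r (a, b, c)) \<partial>count_space UNIV) \<le> ennreal (pmf PA (a, c))" for a c
  proof -
    have "(\<integral>\<^sup>+ b. ennreal (r (a, b, c)) \<partial>count_space UNIV)
        = (\<integral>\<^sup>+ b. ennreal (pmf PA (a, c) / pmf PC c) * ennreal (pmf PB (b, c)) \<partial>count_space UNIV)"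
      by (intro nn_integral_cong) (simp add: r_def ennreal_mult' [symmetric])
    also have "\<dots> = ennreal (pmf PA (a, c) / pmf PC c) * ennreal (pmf PC c)"
      by (simp add: nn_integral_cmult nn_integral_pmf_map_snd sndB)
    also have "\<dots> \<le> ennreal (pmf PA (a, c))"
      by (cases "pmf PC c = 0") (simp_all add: ennreal_mult' [symmetric])
    finally show ?thesis .
  qed
  have r_le_1: "(\<integral>\<^sup>+ y. ennreal (r y) \<partial>count_space UNIV) \<le> 1"
  proof -
    have "(\<integral>\<^sup>+ y. ennreal (r y) \<partial>count_space UNIV)
      = (\<integral>\<^sup>+ a. \<integral>\<^sup>+ bc. ennreal (r (a, bc)) \<partial>count_space UNIV \<partial>count_space UNIV)"
      by (rule nn_integral_fst_count_space[symmetric])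
    also have "\<dots> = (\<integral>\<^sup>+ a. \<integral>\<^sup>+ c. \<integral>\<^sup>+ b. ennreal (r (a, b, c))
        \<partial>count_space UNIV \<partial>count_space UNIV \<partial>count_space UNIV)"
      by (intro nn_integral_cong) (subst nn_integral_snd_count_space, simp)
    also have "\<dots> \<le> (\<integral>\<^sup>+ a. \<integral>\<^sup>+ c. ennreal (pmf PA (a, c)) \<partial>count_space UNIV \<partial>count_space UNIV)"
      by (intro nn_integral_mono inner)
    also have "\<dots> = (\<integral>\<^sup>+ x. ennreal (pmf PA x) \<partial>count_space UNIV)"
      by (rule nn_integral_fst_count_space)
    also have "\<dots> = 1" by (simp add: nn_integral_pmf)
    finally show ?thesis .
  qed
  have r_nonneg: "0 \<le> r y" for y by (auto simp: r_def split: prod.split)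
  \<comment> \<open>In general only an inequality: mass of \<open>r\<close> outside the support of
    \<open>J\<close> is lost under the expectation.\<close>
  have ratio: "(\<integral>\<^sup>+ y. ennreal (r y / pmf J y) \<partial>measure_pmf J) \<le> 1"
  proof -
    have "(\<integral>\<^sup>+ y. ennreal (r y / pmf J y) \<partial>measure_pmf J)
      = (\<integral>\<^sup>+ y. ennreal (pmf J y) * ennreal (r y / pmf J y) \<partial>count_space UNIV)"
      by (rule nn_integral_measure_pmf)
    also have "\<dots> \<le> (\<integral>\<^sup>+ y. ennreal (r y) \<partial>count_space UNIV)"
    proof (intro nn_integral_mono)
      fix y show "ennreal (pmf J y) * ennreal (r y / pmf J y) \<le> ennreal (r y)"
        using r_nonneg[of y] by (cases "pmf J y = 0") (simp_all add: ennreal_mult' [symmetric])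
    qed
    finally show ?thesis using r_le_1 by simp
  qed
  have int_ratio: "integrable (measure_pmf J) (\<lambda>y. r y / pmf J y)"
    using ratio r_nonneg
    by (intro integrableI_nonneg) (auto simp: le_less_trans)
  then have "ennreal (measure_pmf.expectation J (\<lambda>y. r y / pmf J y)) \<le> 1"
    using ratio r_nonneg by (subst nn_integral_eq_integral[symmetric]) auto
  then have exp_ratio: "measure_pmf.expectation J (\<lambda>y. r y / pmf J y) \<le> 1"
    by simp
  let ?t = "\<lambda>x. (A x, B x, C x)"
  have int: "integrable (measure_pmf P) (\<lambda>x. - ln (pmf J (?t x)))"
    "integrable (measure_pmf P) (\<lambda>x. - ln (pmf PA (A x, C x)))"
    "integrable (measure_pmf P) (\<lambda>x. - ln (pmf PB (B x, C x)))"
    "integrable (measure_pmf P) (\<lambda>x. - ln (pmf PC (C x)))"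
    unfolding J_def PA_def PB_def PC_def
    by (rule finite_pmf_entropy_mono[OF fin, unfolded finite_pmf_entropy_def]; simp)+
  have int_r: "integrable (measure_pmf P) (\<lambda>x. r (?t x) / pmf J (?t x))"
    using int_ratio unfolding J_def by simp
  \<comment> \<open>On the support all four probabilities are positive, and the combined integrand
    is the logarithm of \<open>r / pmf J\<close> at \<open>?t x\<close>.\<close>
  have "pmf_entropy P ?t + pmf_entropy P C - pmf_entropy P (\<lambda>x. (A x, C x))
      - pmf_entropy P (\<lambda>x. (B x, C x))
    = measure_pmf.expectation P (\<lambda>x. - ln (pmf J (?t x)) + - ln (pmf PC (C x))
      - - ln (pmf PA (A x, C x)) - - ln (pmf PB (B x, C x)))"
    unfolding pmf_entropy_def J_def[symmetric] PA_def[symmetric] PB_def[symmetric] PC_def[symmetric]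
    by (simp only: int Bochner_Integration.integral_add Bochner_Integration.integral_diff
        Bochner_Integration.integrable_add Bochner_Integration.integrable_diff)
  also have "\<dots> \<le> measure_pmf.expectation P (\<lambda>x. r (?t x) / pmf J (?t x) - 1)"
  proof (rule integral_mono_AE)
    have "- ln (pmf J (?t x)) + - ln (pmf PC (C x)) - - ln (pmf PA (A x, C x))
        - - ln (pmf PB (B x, C x)) \<le> r (?t x) / pmf J (?t x) - 1" if "x \<in> set_pmf P" for x
    proof -
      have pos: "0 < pmf J (?t x)" "0 < pmf PA (A x, C x)" "0 < pmf PB (B x, C x)"
        "0 < pmf PC (C x)"
        unfolding J_def PA_def PB_def PC_def by (rule pmf_map_fiber_pos[OF that])+
      have "ln (r (?t x) / pmf J (?t x)) \<le> r (?t x) / pmf J (?t x) - 1"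
        using pos by (intro ln_le_minus_one) (simp add: r_def)
      then show ?thesis
        using pos by (simp add: r_def ln_div ln_mult)
    qed
    then show "AE x in measure_pmf P. - ln (pmf J (?t x)) + - ln (pmf PC (C x))
        - - ln (pmf PA (A x, C x)) - - ln (pmf PB (B x, C x)) \<le> r (?t x) / pmf J (?t x) - 1"
      by (simp add: AE_measure_pmf_iff)
  qed (intro Bochner_Integration.integrable_add Bochner_Integration.integrable_diff int int_r; simp)+
  also have "\<dots> = measure_pmf.expectation J (\<lambda>y. r y / pmf J y) - 1"
    using int_r by (simp add: J_def)
  also have "\<dots> \<le> 0" using exp_ratio by simp
  finally show ?thesis by simp
qed

section \<open>Entropy of product distributions\<close>

text \<open>The default value \<open>undefined\<close> of \<open>Pi_pmf\<close> is also the one used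
  by \<open>restrict\<close>, so restricting a sample to \<open>S\<close> yields exactly the product
  over \<open>S\<close>.\<close>

lemma Pi_pmf_marginal:
  assumes "finite V" and "S \<subseteq> V"
  shows "pmf (map_pmf (\<lambda>x. restrict x S) (Pi_pmf V undefined (\<lambda>_. q))) (restrict x S)
    = (\<Prod>v\<in>S. pmf q (x v))"
proof -
  have "map_pmf (\<lambda>x. restrict x S) (Pi_pmf V undefined (\<lambda>_. q)) = Pi_pmf S undefined (\<lambda>_. q)"
    unfolding restrict_def by (rule Pi_pmf_subset[OF assms, symmetric])
  moreover have "finite S" using assms by (rule finite_subset[rotated])
  ultimately show ?thesis by (simp add: pmf_Pi')
qed

text \<open>The logarithm turns the product law into a sum over coordinates, each term of which has
  expectation the entropy of \<open>q\<close>.\<close>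

lemma Pi_pmf_marginal_entropy:
  assumes V: "finite V" and S: "S \<subseteq> V" and q: "finite_pmf_entropy q (\<lambda>a. a)"
  defines "P \<equiv> Pi_pmf V undefined (\<lambda>_. q)"
  shows "finite_pmf_entropy P (\<lambda>x. restrict x S)"
    and "pmf_entropy P (\<lambda>x. restrict x S) = real (card S) * pmf_entropy q (\<lambda>a. a)"
proof -
  have comp: "map_pmf (\<lambda>x. x v) P = q" if "v \<in> S" for v
    using that S V by (auto simp: P_def Pi_pmf_component)
  have int: "integrable (measure_pmf P) (\<lambda>x. - ln (pmf q (x v)))"
    and exp: "measure_pmf.expectation P (\<lambda>x. - ln (pmf q (x v))) = pmf_entropy q (\<lambda>a. a)"
    if "v \<in> S" for v
  proof -
    have "integrable (measure_pmf (map_pmf (\<lambda>x. x v) P)) (\<lambda>a. - ln (pmf q a))"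
      using q by (simp add: comp[OF that] finite_pmf_entropy_def map_pmf_ident)
    then show "integrable (measure_pmf P) (\<lambda>x. - ln (pmf q (x v)))"
      by simp
    have "measure_pmf.expectation (map_pmf (\<lambda>x. x v) P) (\<lambda>a. - ln (pmf q a))
        = pmf_entropy q (\<lambda>a. a)"
      by (simp add: comp[OF that] pmf_entropy_def map_pmf_ident)
    then show "measure_pmf.expectation P (\<lambda>x. - ln (pmf q (x v))) = pmf_entropy q (\<lambda>a. a)"
      by simp
  qed
  have ln_eq: "- ln (pmf (map_pmf (\<lambda>x. restrict x S) P) (restrict x S)) = (\<Sum>v\<in>S. - ln (pmf q (x v)))"
    if "x \<in> set_pmf P" for x
  proof -
    have pos: "0 < pmf q (x v)" if "v \<in> S" for v
      using pmf_map_fiber_pos[OF \<open>x \<in> set_pmf P\<close>, of "\<lambda>x. x v"] comp[OF that] by simp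
    have "ln (\<Prod>v\<in>S. pmf q (x v)) = (\<Sum>v\<in>S. ln (pmf q (x v)))"
      using pos finite_subset[OF S V] by (intro ln_prod) (simp_all add: less_imp_neq[symmetric])
    then show ?thesis
      unfolding P_def Pi_pmf_marginal[OF V S] by (simp add: sum_negf)
  qed
  have "integrable (measure_pmf P) (\<lambda>x. \<Sum>v\<in>S. - ln (pmf q (x v)))"
    using int by (intro Bochner_Integration.integrable_sum)
  then show "finite_pmf_entropy P (\<lambda>x. restrict x S)"
    unfolding finite_pmf_entropy_def
    by (rule integrable_cong_AE[THEN iffD1, rotated 3]) (auto simp: AE_measure_pmf_iff ln_eq)
  have "pmf_entropy P (\<lambda>x. restrict x S)
      = measure_pmf.expectation P (\<lambda>x. \<Sum>v\<in>S. - ln (pmf q (x v)))"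
    unfolding pmf_entropy_def by (intro integral_cong_AE) (auto simp: AE_measure_pmf_iff ln_eq)
  also have "\<dots> = (\<Sum>v\<in>S. pmf_entropy q (\<lambda>a. a))"
    using int exp by (subst Bochner_Integration.integral_sum) auto
  finally show "pmf_entropy P (\<lambda>x. restrict x S) = real (card S) * pmf_entropy q (\<lambda>a. a)"
    by simp
qed

text \<open>Samples are extensional on \<open>V\<close>, so the full restriction determines them,
  hence also any \<open>A\<close>; its entropy is finite by the previous lemma.\<close>

lemma finite_pmf_entropy_Pi_pmf:
  assumes V: "finite V" and q: "finite_pmf_entropy q (\<lambda>a. a)"
  shows "finite_pmf_entropy (Pi_pmf V undefined (\<lambda>_. q)) A"
  using Pi_pmf_marginal_entropy(1)[OF V subset_refl q]
proof (rule finite_pmf_entropy_mono)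
  fix x y
  assume "x \<in> set_pmf (Pi_pmf V undefined (\<lambda>_. q))" "y \<in> set_pmf (Pi_pmf V undefined (\<lambda>_. q))"
  then have "x \<in> extensional V" "y \<in> extensional V"
    using set_Pi_pmf_subset[OF V, of undefined "\<lambda>_. q"] by (auto simp: extensional_def)
  moreover assume "restrict x V = restrict y V"
  ultimately show "A x = A y" by (simp add: extensional_restrict)
qed

section \<open>Passage from discrete random variables to pmfs\<close>

text \<open>With a countable range, measurable point events make every preimage measurable, so the
  law lives on the whole type and is carried by its atoms. The support bound later places the values
  in \<open>\<Omega>\<close>.\<close>

lemma countable_range_law_exists:
  assumes "prob_space M"
    and meas: "\<And>y. {\<omega> \<in> space M. Y \<omega> = y} \<in> sets M"
    and count: "countable (Y ` space M)"
  shows "\<exists>P. (\<forall>S. measure (measure_pmf P) S = measure M {\<omega> \<in> space M. Y \<omega> \<in> S})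
    \<and> set_pmf P \<subseteq> Y ` space M"
proof -
  interpret prob_space M by fact
  have vim: "{\<omega> \<in> space M. Y \<omega> \<in> S} \<in> sets M" for S
  proof -
    have "{\<omega> \<in> space M. Y \<omega> \<in> S} = (\<Union>y\<in>S \<inter> Y ` space M. {\<omega> \<in> space M. Y \<omega> = y})"
      by auto
    also have "\<dots> \<in> sets M"
      using meas count by (intro sets.countable_UN') auto
    finally show ?thesis .
  qed
  have Y: "Y \<in> M \<rightarrow>\<^sub>M count_space UNIV"
    using vim by (auto simp: measurable_def vimage_def Int_def conj_commute)
  define D where "D = distr M (count_space UNIV) Y"
  have D: "measure D S = measure M {\<omega> \<in> space M. Y \<omega> \<in> S}" for S
    unfolding D_def using Y by (subst measure_distr) (auto intro!: arg_cong[where f = "measure M"])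
  interpret D: prob_space D unfolding D_def by (rule prob_space_distr[OF Y])
  \<comment> \<open>This is the condition for \<open>Abs_pmf\<close>. The range is countable, so its
    values of probability 0 are avoided simultaneously almost surely.\<close>
  have "AE x in D. measure D {x} \<noteq> 0"
    unfolding D_def
  proof (subst AE_distr_iff[OF Y])
    have "AE \<omega> in M. \<forall>y\<in>Y ` space M. measure D {y} = 0 \<longrightarrow> Y \<omega> \<noteq> y"
    proof (rule AE_ball_countable[OF count, THEN iffD2], intro ballI)
      fix y
      show "AE \<omega> in M. measure D {y} = 0 \<longrightarrow> Y \<omega> \<noteq> y"
      proof (cases "measure D {y} = 0")
        case True
        then have "{\<omega> \<in> space M. Y \<omega> = y} \<in> null_sets M"
          using meas[of y] D[of "{y}"] by (auto simp: null_sets_def emeasure_eq_measure)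
        then show ?thesis by (rule AE_I') auto
      qed simp
    qed
    with AE_space show "AE \<omega> in M. measure (distr M (count_space UNIV) Y) {Y \<omega>} \<noteq> 0"
      unfolding D_def[symmetric] by eventually_elim auto
  qed auto
  then have P: "measure_pmf (Abs_pmf D) = D"
    by (intro Abs_pmf_inverse) (simp add: D.prob_space_axioms, simp add: D_def)
  have "set_pmf (Abs_pmf D) \<subseteq> Y ` space M"
  proof
    fix y assume "y \<in> set_pmf (Abs_pmf D)"
    then have "measure D {y} \<noteq> 0" by (simp add: set_pmf.rep_eq P)
    then have "{\<omega> \<in> space M. Y \<omega> \<in> {y}} \<noteq> {}" using D[of "{y}"] by (metis measure_empty)
    then show "y \<in> Y ` space M" by auto
  qed
  then show ?thesis using P D by (intro exI[of _ "Abs_pmf D"]) auto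
qed

text \<open>For real terms \<open>summable_on\<close> coincides with absolute summability, which is
  integrability against counting measure; \<open>pmf Q\<close> is the density.\<close>

lemma finite_pmf_entropy_iff_summable:
  "finite_pmf_entropy Q (\<lambda>y. y) \<longleftrightarrow> (\<lambda>y. pmf Q y * ln (pmf Q y)) summable_on UNIV"
proof -
  have "finite_pmf_entropy Q (\<lambda>y. y)
      \<longleftrightarrow> integrable (density (count_space UNIV) (\<lambda>y. ennreal (pmf Q y))) (\<lambda>y. ln (pmf Q y))"
    by (simp add: finite_pmf_entropy_def map_pmf_ident measure_pmf_eq_density[symmetric])
  also have "\<dots> \<longleftrightarrow> integrable (count_space UNIV) (\<lambda>y. pmf Q y * ln (pmf Q y))"
    by (subst integrable_density) auto
  also have "\<dots> \<longleftrightarrow> (\<lambda>y. pmf Q y * ln (pmf Q y)) summable_on UNIV"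
    unfolding abs_summable_on_def[symmetric] abs_summable_equivalent[symmetric]
    by (rule summable_on_iff_abs_summable_on_real[symmetric])
  finally show ?thesis .
qed

lemma pmf_entropy_eq_infsum:
  assumes "finite_pmf_entropy Q (\<lambda>y. y)"
  shows "pmf_entropy Q (\<lambda>y. y) = - (\<Sum>\<^sub>\<infinity>y. pmf Q y * ln (pmf Q y))"
proof -
  have "(\<lambda>y. pmf Q y * ln (pmf Q y)) summable_on UNIV"
    using assms by (simp add: finite_pmf_entropy_iff_summable)
  then have abs: "Infinite_Set_Sum.abs_summable_on (\<lambda>y. pmf Q y * ln (pmf Q y)) UNIV"
    unfolding abs_summable_equivalent[symmetric]
    by (rule summable_on_iff_abs_summable_on_real[THEN iffD1])
  have "pmf_entropy Q (\<lambda>y. y) = - measure_pmf.expectation Q (\<lambda>y. ln (pmf Q y))"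
    by (simp add: pmf_entropy_def map_pmf_ident)
  also have "\<dots> = - infsetsum (\<lambda>y. pmf Q y * ln (pmf Q y)) UNIV"
    by (simp add: pmf_expectation_eq_infsetsum)
  finally show ?thesis using infsetsum_infsum[OF abs] by simp
qed

lemma finite_pmf_entropy_map_pmf:
  "finite_pmf_entropy (map_pmf T P) A \<longleftrightarrow> finite_pmf_entropy P (A \<circ> T)"
  by (simp add: finite_pmf_entropy_def pmf.map_comp)

lemma point_prob_law:
  assumes "\<And>S. measure (measure_pmf P) S = measure M {\<omega> \<in> space M. Y \<omega> \<in> S}"
  shows "point_prob M (\<lambda>\<omega>. A (Y \<omega>)) = pmf (map_pmf A P)"
  by (rule ext) (simp add: point_prob_def pmf_map assms vimage_def)

lemma discrete_entropy_law:
  assumes "\<And>S. measure (measure_pmf P) S = measure M {\<omega> \<in> space M. Y \<omega> \<in> S}"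
    and "finite_pmf_entropy P A"
  shows "discrete_entropy M (\<lambda>\<omega>. A (Y \<omega>)) = pmf_entropy P A"
  using pmf_entropy_eq_infsum[of "map_pmf A P"] assms(2)
  by (simp add: discrete_entropy_def point_prob_law[OF assms(1)] finite_pmf_entropy_map_pmf
      pmf_entropy_map_pmf o_def)

section \<open>Information carried by coordinates of a product about a transitive function\<close>

lemma Pi_pmf_permute_coordinates:
  assumes "finite V" and "bij_betw \<gamma> V V"
  shows "map_pmf (\<lambda>x. \<lambda>v\<in>V. x (\<gamma> v)) (Pi_pmf V undefined (\<lambda>_. q)) = Pi_pmf V undefined (\<lambda>_. q)"
proof -
  \<comment> \<open>\<open>\<gamma>\<close> is uncontrolled outside \<open>V\<close>, whereas
    reindexing a \<open>Pi_pmf\<close> requires points outside \<open>V\<close> to stay outside;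
    \<open>h\<close> fixes them.\<close>
  define h where "h v = (if v \<in> V then \<gamma> v else v)" for v
  have "bij_betw h V V"
    using assms(2) by (rule bij_betw_cong[THEN iffD1, rotated]) (simp add: h_def)
  then have "Pi_pmf V undefined (\<lambda>_. q) = map_pmf (\<lambda>x. x \<circ> h) (Pi_pmf V undefined (\<lambda>_. q))"
    using assms(1) by (intro Pi_pmf_bij_betw) (auto simp: h_def)
  also have "\<dots> = map_pmf (\<lambda>x. \<lambda>v\<in>V. x (\<gamma> v)) (Pi_pmf V undefined (\<lambda>_. q))"
    using set_Pi_pmf_subset[OF assms(1), of undefined "\<lambda>_. q"]
    by (intro map_pmf_cong) (auto simp: h_def fun_eq_iff restrict_def)
  finally show ?thesis by simp
qed

lemma Pi_pmf_transitive_information_bound: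
  fixes q :: "'a pmf" and f :: "('v \<Rightarrow> 'a) \<Rightarrow> real"
  assumes V: "finite V" and q: "finite_pmf_entropy q (\<lambda>a. a)"
    and \<Omega>: "set_pmf q \<subseteq> \<Omega>" and f: "transitive_function V \<Omega> f" and U: "U \<subseteq> V"
  defines "P \<equiv> Pi_pmf V undefined (\<lambda>_. q)"
  shows "real (card V) * (pmf_entropy P f + pmf_entropy P (\<lambda>x. restrict x U)
      - pmf_entropy P (\<lambda>x. (f x, restrict x U))) \<le> real (card U) * pmf_entropy P f"
proof -
  obtain \<Gamma> where \<Gamma>: "subgroup \<Gamma> (BijGroup V)"
    and trans: "\<forall>u\<in>V. \<forall>v\<in>V. \<exists>\<gamma>\<in>\<Gamma>. \<gamma> u = v"
    and f_inv: "\<forall>\<gamma>\<in>\<Gamma>. \<forall>x \<in> V \<rightarrow>\<^sub>E \<Omega>. f (\<lambda>v\<in>V. x (\<gamma> v)) = f x"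
    using f unfolding transitive_function_def by (elim exE conjE)
  \<comment> \<open>The invariance of \<open>f\<close> is available only for extensional,
    \<open>\<Omega>\<close>-valued arguments; samples are of this kind.\<close>
  have supp: "x \<in> V \<rightarrow>\<^sub>E \<Omega>" if "x \<in> set_pmf P" for x
    using that \<Omega> unfolding P_def set_Pi_pmf[OF V] PiE_dflt_def by (auto simp: PiE_def extensional_def)
  have restrict_V: "restrict x V = x" if "x \<in> set_pmf P" for x
    using supp[OF that] by (simp add: PiE_restrict)
  have marg: "pmf_entropy P (\<lambda>x. restrict x S) = real (card S) * pmf_entropy q (\<lambda>a. a)"
    if "S \<subseteq> V" for S
    unfolding P_def by (rule Pi_pmf_marginal_entropy(2)[OF V that q])
  have res: "restrict x S = restrict y S \<longleftrightarrow> (\<forall>v\<in>S. x v = y v)" for x y :: "'v \<Rightarrow> 'a" and S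
    by (auto simp: restrict_def fun_eq_iff)
  define g where "g S = pmf_entropy P f + pmf_entropy P (\<lambda>x. restrict x S)
      - pmf_entropy P (\<lambda>x. (f x, restrict x S))" for S
  have "pmf_entropy P (\<lambda>x. (f x, restrict x {})) = pmf_entropy P f"
    by (rule pmf_entropy_cong) (simp add: restrict_def)
  then have g0: "g {} = 0"
    using marg[of "{}"] by (simp add: g_def)
  have super: "g S + g T \<le> g (S \<union> T) + g (S \<inter> T)" if ST: "S \<subseteq> V" "T \<subseteq> V" for S T
  proof -
    \<comment> \<open>The conditioning variable contains both \<open>f x\<close> and the common
      coordinates. Together with the coordinates in \<open>S\<close> and in \<open>T\<close> it has
      the same fibers as \<open>f x\<close> with those in \<open>S \<union> T\<close>.\<close>
    let ?C = "\<lambda>x. (f x, restrict x (S \<inter> T))"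
    have "pmf_entropy P (\<lambda>x. (restrict x S, restrict x T, ?C x)) + pmf_entropy P ?C
        \<le> pmf_entropy P (\<lambda>x. (restrict x S, ?C x)) + pmf_entropy P (\<lambda>x. (restrict x T, ?C x))"
      by (rule pmf_entropy_submodular) (simp only: P_def finite_pmf_entropy_Pi_pmf[OF V q])
    moreover have "pmf_entropy P (\<lambda>x. (restrict x S, restrict x T, ?C x))
        = pmf_entropy P (\<lambda>x. (f x, restrict x (S \<union> T)))"
      "pmf_entropy P (\<lambda>x. (restrict x S, ?C x)) = pmf_entropy P (\<lambda>x. (f x, restrict x S))"
      "pmf_entropy P (\<lambda>x. (restrict x T, ?C x)) = pmf_entropy P (\<lambda>x. (f x, restrict x T))"
      by (rule pmf_entropy_cong; unfold prod.inject res; blast)+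
    moreover have "real (card S) + real (card T) = real (card (S \<union> T)) + real (card (S \<inter> T))"
      using card_Un_Int[of S T] ST V by (metis finite_subset of_nat_add)
    then have "pmf_entropy P (\<lambda>x. restrict x S) + pmf_entropy P (\<lambda>x. restrict x T)
        = pmf_entropy P (\<lambda>x. restrict x (S \<union> T)) + pmf_entropy P (\<lambda>x. restrict x (S \<inter> T))"
      using ST by (simp add: marg le_infI1 distrib_right[symmetric])
    ultimately show ?thesis unfolding g_def by linarith
  qed
  have inv: "g (\<gamma> ` S) = g S" if \<gamma>: "\<gamma> \<in> \<Gamma>" and S: "S \<subseteq> V" for \<gamma> S
  proof -
    have bij: "bij_betw \<gamma> V V"
      using subgroup.mem_carrier[OF \<Gamma> \<gamma>] by (simp add: BijGroup_def Bij_def)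
    let ?T = "\<lambda>x. \<lambda>v\<in>V. x (\<gamma> v)"
    have "pmf_entropy P (\<lambda>x. (f x, restrict x S)) = pmf_entropy (map_pmf ?T P) (\<lambda>x. (f x, restrict x S))"
      unfolding P_def by (simp only: Pi_pmf_permute_coordinates[OF V bij])
    also have "\<dots> = pmf_entropy P (\<lambda>x. (f (?T x), restrict (?T x) S))"
      by (simp add: pmf_entropy_map_pmf o_def)
    also have "\<dots> = pmf_entropy P (\<lambda>x. (f x, restrict x (\<gamma> ` S)))"
    proof (rule pmf_entropy_cong)
      fix x y assume "x \<in> set_pmf P" "y \<in> set_pmf P"
      then have "f (?T x) = f x" "f (?T y) = f y" using bspec[OF f_inv \<gamma>] supp by blast+
      moreover have "(\<forall>v\<in>S. ?T x v = ?T y v) \<longleftrightarrow> (\<forall>v\<in>\<gamma> ` S. x v = y v)"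
        using S by (auto simp: subset_iff)
      ultimately show "(f (?T x), restrict (?T x) S) = (f (?T y), restrict (?T y) S)
          \<longleftrightarrow> (f x, restrict x (\<gamma> ` S)) = (f y, restrict y (\<gamma> ` S))"
        unfolding prod.inject res by simp
    qed
    finally have "pmf_entropy P (\<lambda>x. (f x, restrict x (\<gamma> ` S))) = pmf_entropy P (\<lambda>x. (f x, restrict x S))"
      by simp
    moreover have "\<gamma> ` S \<subseteq> V" "card (\<gamma> ` S) = card S"
      using bij S by (auto simp: bij_betw_def inj_on_subset card_image)
    ultimately show ?thesis using S by (simp add: g_def marg)
  qed
  \<comment> \<open>All coordinates together determine \<open>f x\<close>, so adjoining it adds no
    entropy.\<close>
  have "pmf_entropy P (\<lambda>x. (f x, restrict x V)) = pmf_entropy P (\<lambda>x. restrict x V)"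
    by (rule pmf_entropy_cong) (auto simp: restrict_V)
  then have "g V = pmf_entropy P f" by (simp add: g_def)
  then show ?thesis
    using supermodular_transitive_bound[OF V g0 super \<Gamma> bspec[OF bspec[OF trans]] inv U] by (simp add: g_def)
qed

section \<open>Identification of the joint law and conclusion\<close>

theorem theorem1p4:
  fixes M :: "'m measure"
    and V :: "'v set"
    and \<Omega> :: "'a set"
    and X :: "'v \<Rightarrow> 'm \<Rightarrow> 'a"
    and f :: "('v \<Rightarrow> 'a) \<Rightarrow> real"
    and U :: "'v set"
  assumes "prob_space M"
    and "finite V" and "V \<noteq> {}"
    and "\<And>v. v \<in> V \<Longrightarrow> discrete_rv M \<Omega> (X v)"
    and "prob_space.indep_vars M (\<lambda>_. count_space \<Omega>) X V"
    and "\<And>u v. u \<in> V \<Longrightarrow> v \<in> V \<Longrightarrow>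
           distr M (count_space \<Omega>) (X u) = distr M (count_space \<Omega>) (X v)"
    and "\<And>v. v \<in> V \<Longrightarrow> finite_entropy_rv M (X v)"
    and "transitive_function V \<Omega> f"
    and "discrete_entropy M (\<lambda>\<omega>. f (subfamily X V \<omega>)) > 0"
    and "U \<subseteq> V"
  shows "clue_I M X V f U \<le> real (card U) / real (card V)"
proof -
  interpret prob_space M by fact
  note V = \<open>finite V\<close> and U = \<open>U \<subseteq> V\<close>
  have meas: "X v \<in> M \<rightarrow>\<^sub>M count_space \<Omega>" and count: "countable (X v ` space M)" if "v \<in> V" for v
    using assms(4)[OF that] by (auto simp: discrete_rv_def)
  have X_\<Omega>: "X v \<omega> \<in> \<Omega>" if "v \<in> V" "\<omega> \<in> space M" for v \<omega>
    using measurable_space[OF meas[OF that(1)] that(2)] by simp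
  have ev: "{\<omega> \<in> space M. X v \<omega> = a} \<in> sets M" if "v \<in> V" for v a
  proof -
    have "{\<omega> \<in> space M. X v \<omega> = a} = X v -` ({a} \<inter> \<Omega>) \<inter> space M"
      using X_\<Omega>[OF that] by auto
    then show ?thesis using measurable_sets[OF meas[OF that], of "{a} \<inter> \<Omega>"] by simp
  qed
  obtain v0 where v0: "v0 \<in> V" using \<open>V \<noteq> {}\<close> by blast
  obtain q where q: "\<And>S. measure (measure_pmf q) S = measure M {\<omega> \<in> space M. X v0 \<omega> \<in> S}"
    and q_supp: "set_pmf q \<subseteq> X v0 ` space M"
    using countable_range_law_exists[OF \<open>prob_space M\<close> ev[OF v0] count[OF v0]] by blast
  have pmf_q: "pmf q a = prob {\<omega> \<in> space M. X v \<omega> = a}" if v: "v \<in> V" for v a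
  proof -
    \<comment> \<open>The equal laws live on \<open>count_space \<Omega>\<close>, so
      \<open>{a}\<close> is cut down to \<open>\<Omega>\<close>; for \<open>a\<close> outside
      \<open>\<Omega>\<close> both events are empty.\<close>
    have *: "prob {\<omega> \<in> space M. X w \<omega> = a} = measure (distr M (count_space \<Omega>) (X w)) ({a} \<inter> \<Omega>)"
      if "w \<in> V" for w
      using X_\<Omega>[OF that]
      by (subst measure_distr[OF meas[OF that]]) (auto intro!: arg_cong[where f = prob])
    have "pmf q a = prob {\<omega> \<in> space M. X v0 \<omega> = a}"
      using q[of "{a}"] by (simp add: pmf.rep_eq)
    then show ?thesis using *[OF v0] *[OF v] assms(6)[OF v0 v] by simp
  qed
  have q_fin: "finite_pmf_entropy q (\<lambda>a. a)"
  proof -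
    have "point_prob M (X v0) = pmf q"
      using pmf_q[OF v0] by (simp add: fun_eq_iff point_prob_def)
    then show ?thesis
      using assms(7)[OF v0] by (simp add: finite_pmf_entropy_iff_summable finite_entropy_rv_def)
  qed
  define Y where "Y = subfamily X V"
  have Y_eq: "{\<omega> \<in> space M. Y \<omega> = x} = (\<Inter>v\<in>V. {\<omega> \<in> space M. X v \<omega> = x v})"
    if "x \<in> extensional V" for x
    using that \<open>V \<noteq> {}\<close>
    by (auto simp: Y_def subfamily_def fun_eq_iff extensional_def)
  have Y_ext: "{\<omega> \<in> space M. Y \<omega> = x} = {}" if "x \<notin> extensional V" for x
    using that by (auto simp: Y_def subfamily_def)
  have Y_meas: "{\<omega> \<in> space M. Y \<omega> = x} \<in> sets M" for x
  proof (cases "x \<in> extensional V")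
    case True
    show ?thesis unfolding Y_eq[OF True] using V \<open>V \<noteq> {}\<close> ev by (intro sets.finite_INT) auto
  qed (simp add: Y_ext)
  have "Y ` space M \<subseteq> (\<Pi>\<^sub>E v\<in>V. X v ` space M)"
    by (auto simp: Y_def subfamily_def)
  then have Y_count: "countable (Y ` space M)"
    by (rule countable_subset) (intro countable_PiE V count)
  obtain P where P: "\<And>S. measure (measure_pmf P) S = measure M {\<omega> \<in> space M. Y \<omega> \<in> S}"
    using countable_range_law_exists[OF \<open>prob_space M\<close> Y_meas Y_count] by blast
  \<comment> \<open>Point masses are compared: independence factors those at extensional
    \<open>x\<close>, and all other points have mass 0 on both sides.\<close>
  have P_eq: "P = Pi_pmf V undefined (\<lambda>_. q)"
  proof (rule pmf_eqI)
    fix x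
    have P_x: "pmf P x = prob {\<omega> \<in> space M. Y \<omega> = x}"
      using P[of "{x}"] by (simp add: pmf.rep_eq)
    show "pmf P x = pmf (Pi_pmf V undefined (\<lambda>_. q)) x"
    proof (cases "x \<in> extensional V")
      case True
      have vim: "{\<omega> \<in> space M. X v \<omega> = x v} = X v -` ({x v} \<inter> \<Omega>) \<inter> space M" if "v \<in> V" for v
        using X_\<Omega>[OF that] by auto
      have "(\<Inter>v\<in>V. {\<omega> \<in> space M. X v \<omega> = x v}) = (\<Inter>v\<in>V. X v -` ({x v} \<inter> \<Omega>) \<inter> space M)"
        using vim by (intro INF_cong refl)
      also have "prob \<dots> = (\<Prod>v\<in>V. prob (X v -` ({x v} \<inter> \<Omega>) \<inter> space M))"
        using assms(5) \<open>V \<noteq> {}\<close> V by (rule indep_varsD_finite) simp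
      also have "\<dots> = (\<Prod>v\<in>V. pmf q (x v))"
        by (intro prod.cong refl) (simp only: vim[symmetric] pmf_q)
      finally have "pmf P x = (\<Prod>v\<in>V. pmf q (x v))"
        by (simp only: P_x Y_eq[OF True])
      then show ?thesis
        using True V by (simp add: pmf_Pi' extensional_def)
    next
      case False
      then show ?thesis
        using V by (auto simp: P_x Y_ext pmf_Pi extensional_def)
    qed
  qed
  \<comment> \<open>Every function of \<open>Y\<close> has finite entropy under the product law, so
    all three entropies in the mutual information transfer to \<open>P\<close>.\<close>
  have ent: "discrete_entropy M (\<lambda>\<omega>. A (Y \<omega>)) = pmf_entropy P A" for A :: "('v \<Rightarrow> 'a) \<Rightarrow> 'b"
    using P by (rule discrete_entropy_law) (simp only: P_eq finite_pmf_entropy_Pi_pmf[OF V q_fin])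
  have "subfamily X U = (\<lambda>\<omega>. restrict (Y \<omega>) U)"
    using U by (auto simp: Y_def subfamily_def fun_eq_iff)
  then have info: "mutual_info M (\<lambda>\<omega>. f (Y \<omega>)) (subfamily X U)
      = pmf_entropy P f + pmf_entropy P (\<lambda>x. restrict x U) - pmf_entropy P (\<lambda>x. (f x, restrict x U))"
    by (simp add: mutual_info_def ent[of f] ent[of "\<lambda>x. restrict x U"]
        ent[of "\<lambda>x. (f x, restrict x U)"])
  have "set_pmf q \<subseteq> \<Omega>" using q_supp X_\<Omega>[OF v0] by auto
  then have "real (card V) * mutual_info M (\<lambda>\<omega>. f (Y \<omega>)) (subfamily X U)
      \<le> real (card U) * discrete_entropy M (\<lambda>\<omega>. f (Y \<omega>))"
    unfolding info ent P_eq
    by (intro Pi_pmf_transitive_information_bound[OF V q_fin _ assms(8) U])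
  moreover have "0 < discrete_entropy M (\<lambda>\<omega>. f (Y \<omega>))" using assms(9) by (simp add: Y_def)
  moreover have "0 < real (card V)" using V \<open>V \<noteq> {}\<close> by (simp add: card_gt_0_iff)
  ultimately show ?thesis
    by (simp add: clue_I_eq_entropy_ratio Y_def[symmetric] field_simps)
qed

end
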